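(* For every integer $\ell\ge 1$ and every $k\in I_\ell$, the rational numbers $S[k,\Omega(k)-1]$ and $S[k,\Omega(k)]$ satisfy $$S[k,\Omega(k)-1]\;<\;2\;<\;S[k,\Omega(k)],$$ that is, $$\left(1+\frac{1}{3k-\Omega(k)+1}\right)^{2k+1}<2<\left(1+\frac{1}{3k-\Omega(k)}\right)^{2k+1}.$$
   Context: For a positive integer $k$ and an integer $m<3k$ put $$S[k,m]=\left(1+\frac{1}{3k-m}\right)^{2k+1}.$$ The auxiliary integer step function $\Omega$ is defined for real $x>0$ by $$\Omega(x)=\left\lceil 3x-\frac{1}{2^{1/(2x+1)}-1}\right\rceil ,$$ where $\lceil y\rceil$ is the smallest integer greater than or equal to $y$. (Equivalently, $\Omega(x)$ is the least $m\in\{0,1,2,\dots\}$ with $m<3x$ and $\left(1+\frac{1}{3x-m}\right)^{2x+1}\ge 2$.) For each integer $\ell\ge 1$, $I_\ell$ is the set of positive integers $k$ with $\Omega(k)=\ell-1$; for instance $I_1=\{1,\dots,8\}$, $I_2=\{9,\dots,16\}$, $I_3=\{17,\dots,25\}$. *)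

theory Defs
  imports Complex_Main
begin

text \<open>Only meaningful for \<open>k > 0\<close> and \<open>m < 3 * k\<close>.\<close>
definition S :: "nat \<Rightarrow> int \<Rightarrow> rat" where
  "S k m = (1 + 1 / of_int (3 * int k - m)) ^ (2 * k + 1)"

text \<open>Only meaningful for \<open>x > 0\<close>.\<close>
definition Omega :: "real \<Rightarrow> int" where
  "Omega x = \<lceil>3 * x - 1 / (2 powr (1 / (2 * x + 1)) - 1)\<rceil>"

definition I :: "int \<Rightarrow> nat set" where
  "I l = {k. k > 0 \<and> Omega (real k) = l - 1}"

end

theory Submission
  imports Defs
begin

text \<open>
  For fixed \<open>n = 2 * k + 1\<close> the quantity \<open>(1 + 1 / y) ^ n\<close> is decreasing in \<open>y > 0\<close> and passes
  the value 2 at \<open>a = 1 / (2 powr (1 / n) - 1)\<close>.  Since \<open>Omega k\<close> is the ceiling of \<open>3 * k - a\<close>,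
  the integer \<open>j = 3 * k - Omega k\<close> is the floor of \<open>a\<close>, so \<open>j \<le> a < j + 1\<close>
  (lemma \<open>two_le_power_iff\<close> turns this into the bounds on the two powers), and \<open>j \<ge> 1\<close> because
  \<open>2 powr (1 / n) \<le> 2\<close>.  What remains is that the right-hand bound is strict: \<open>(1 + 1 / j) ^ n\<close>
  never equals 2 for \<open>n > 1\<close>, since \<open>j\<close> and \<open>j + 1\<close> are coprime (lemma \<open>one_plus_inverse_power_neq_two\<close>).
\<close>

lemma two_le_power_iff:
  fixes y :: real and n :: nat
  assumes "y > 0" and "n > 0"
  shows "2 \<le> (1 + 1 / y) ^ n \<longleftrightarrow> y \<le> 1 / (2 powr (1 / n) - 1)"
proof -
  define r :: real where "r = 2 powr (1 / n)"
  have r: "r ^ n = 2" "r > 1"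
    using assms(2) by (simp_all add: r_def powr_power)
  have "2 \<le> (1 + 1 / y) ^ n \<longleftrightarrow> r \<le> 1 + 1 / y"
    using r assms power_mono_iff[of r "1 + 1 / y" n] by simp
  also have "\<dots> \<longleftrightarrow> y \<le> 1 / (r - 1)"
    using assms r by (simp add: field_simps)
  finally show ?thesis
    by (simp add: r_def)
qed

text \<open>
  An equality would read \<open>(j + 1) ^ n = 2 * j ^ n\<close>, so \<open>j ^ n\<close> would divide a number coprime to it,
  forcing \<open>j = 1\<close> and then \<open>2 ^ n = 2\<close>.
\<close>
lemma one_plus_inverse_power_neq_two:
  fixes j :: int and n :: nat
  assumes "j > 0" and "n > 1"
  shows "(1 + 1 / of_int j :: rat) ^ n \<noteq> 2"
proof
  assume "(1 + 1 / of_int j :: rat) ^ n = 2"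
  moreover have "(1 + 1 / of_int j :: rat) = of_int (j + 1) / of_int j"
    using assms by (simp add: field_simps)
  ultimately have "(of_int (j + 1) :: rat) ^ n = 2 * of_int j ^ n"
    using assms by (simp add: power_divide field_simps)
  then have "(of_int ((j + 1) ^ n) :: rat) = of_int (2 * j ^ n)"
    by simp
  then have eq: "(j + 1) ^ n = 2 * j ^ n"
    by (simp only: of_int_eq_iff)
  then have "j ^ n dvd (j + 1) ^ n"
    by simp
  moreover have "coprime (j ^ n) ((j + 1) ^ n)"
    by simp
  ultimately have "is_unit (j ^ n)"
    by (metis coprime_absorb_left)
  then have "j = 1"
    using assms power_eq_iff_eq_base[of n j 1] by simp
  with eq have "(2::int) ^ n = 2 ^ 1"
    by simp
  then show False
    using assms(2) power_inject_exp[of "2::int" n 1] by simp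
qed

theorem mainTheorem1:
  fixes l :: int and k :: nat
  assumes "l \<ge> 1" and "k \<in> I l"
  shows "S k (Omega (real k) - 1) < 2 \<and> 2 < S k (Omega (real k))"
proof -
  have "k > 0"
    using assms(2) by (simp add: I_def)
  define n where "n = 2 * k + 1"
  have n: "n > 1"
    using \<open>k > 0\<close> by (simp add: n_def)
  define a :: real where "a = 1 / (2 powr (1 / n) - 1)"
  define j where "j = 3 * int k - Omega (real k)"
  have Omega: "Omega (real k) = \<lceil>3 * real k - a\<rceil>"
    by (simp add: Omega_def a_def n_def add.commute)
  have bounds: "real_of_int j \<le> a" "a < real_of_int (j + 1)"
    unfolding j_def Omega by (simp; linarith)+
  \<comment> \<open>At \<open>y = 1\<close> the power is \<open>2 ^ n\<close>, so \<open>1 \<le> a\<close> and the integer below \<open>a\<close> is positive.\<close>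
  have "(2::real) \<le> 2 ^ n"
    using n power_increasing[of 1 n "2::real"] by simp
  then have "1 \<le> a"
    using two_le_power_iff[of 1 n] n by (simp add: a_def)
  with bounds(2) have "j > 0"
    by linarith
  have less_iff: "(1 + 1 / of_int i :: rat) ^ n < 2 \<longleftrightarrow> a < of_int i" if "i > 0" for i :: int
  proof -
    have "(1 + 1 / of_int i :: rat) ^ n < 2
        \<longleftrightarrow> real_of_rat ((1 + 1 / of_int i) ^ n) < real_of_rat 2"
      by (simp only: of_rat_less)
    also have "\<dots> \<longleftrightarrow> (1 + 1 / real_of_int i) ^ n < 2"
      by (simp add: of_rat_power of_rat_add of_rat_divide)
    also have "\<dots> \<longleftrightarrow> a < of_int i"
      using two_le_power_iff[of "real_of_int i" n] that n by (simp add: a_def flip: not_le)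
    finally show ?thesis .
  qed
  have "(1 + 1 / of_int (j + 1) :: rat) ^ n < 2"
    using less_iff[of "j + 1"] bounds(2) \<open>j > 0\<close> by linarith
  moreover have "2 < (1 + 1 / of_int j :: rat) ^ n"
    using less_iff[of j] bounds(1) \<open>j > 0\<close> one_plus_inverse_power_neq_two[OF \<open>j > 0\<close> n]
    by linarith
  moreover have "3 * int k - (Omega (real k) - 1) = j + 1"
    by (simp add: j_def)
  ultimately show ?thesis
    unfolding S_def n_def by (simp only: j_def)
qed

end
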